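(* Let $I,J\subset\mathbb{R}$ be nonempty open intervals, let $f:I\to\mathbb{R}$ and $g:J\to\mathbb{R}$ be smooth, and let $M$ be the Type I translation surface in Minkowski space $\mathbb{R}^3_1$ parametrized by $\mathcal{F}(u,v)=(u,v,f(u)+g(v))$, $(u,v)\in I\times J$. Assume $M$ is spacelike. Then $M$ is minimal with respect to the semi-symmetric non-metric connection $\overline\nabla$ if and only if $\mathcal{F}$ is of one of the following forms on $I\times J$: (i) $\mathcal{F}(u,v)=(u,\,v,\,c_1u+c_2v+c_3)$ for some real constants $c_1,c_2,c_3$; (ii) $\mathcal{F}(u,v)=\Big(u,\,v,\,\frac{1}{c_0}\ln\frac{|e^{c_0u}-\widehat c\,e^{-c_0u}|}{|e^{-c_0v}-\widehat c_1e^{c_0v}|}+a\Big)$ for some real constants $a,c_0,\widehat c,\widehat c_1$ with $c_0,\widehat c,\widehat c_1\neq0$ (with $e^{c_0u}-\widehat c\,e^{-c_0u}$ nonvanishing on $I$ and $e^{-c_0v}-\widehat c_1e^{c_0v}$ nonvanishing on $J$).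
   Context: $\mathbb{R}^3_1$ is $\mathbb{R}^3$ with the Minkowski metric $\widetilde g_1=dx^2+dy^2-dz^2$, coordinate fields $X_1=\partial_x$, $X_2=\partial_y$, $X_3=\partial_z$ and Levi-Civita connection $\nabla^L$ (so $\nabla^L_{X_i}X_j=0$). The semi-symmetric non-metric connection $\overline\nabla$ is $$\overline\nabla_XY=\nabla^L_XY+\widetilde g_1(Y,X_3)X .$$ A surface is spacelike if the metric induced on it by $\widetilde g_1$ is Riemannian (positive definite). For a spacelike surface $M$ parametrized by $\mathcal{F}(u,v)$, put $E_1=\mathcal{F}_u$, $E_2=\mathcal{F}_v$, let $N$ be a unit (timelike) normal field, $\widetilde g_1(N,N)=-1$, and let $E=\widetilde g_1(\mathcal{F}_u,\mathcal{F}_u)$, $F=\widetilde g_1(\mathcal{F}_u,\mathcal{F}_v)$, $G=\widetilde g_1(\mathcal{F}_v,\mathcal{F}_v)$. $M$ is minimal with respect to $\overline\nabla$ if its mean curvature with respect to $\overline\nabla$ vanishes everywhere, i.e. $$G\,\widetilde g_1(\overline\nabla_{E_1}E_1,N)-F\,\widetilde g_1(\overline\nabla_{E_1}E_2,N)-F\,\widetilde g_1(\overline\nabla_{E_2}E_1,N)+E\,\widetilde g_1(\overline\nabla_{E_2}E_2,N)=0 .$$ *)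

theory Defs
  imports "HOL-Analysis.Analysis"
begin

definition mink :: "real^3 \<Rightarrow> real^3 \<Rightarrow> real" where
  "mink x y = x $ 1 * y $ 1 + x $ 2 * y $ 2 - x $ 3 * y $ 3"

text \<open>The field \<open>\<partial>\<^sub>z\<close>, i.e. \<open>X\<^sub>3\<close>, which is constant in the identification of every tangent
  space with \<open>\<real>\<^sup>3\<close>.\<close>

definition X3 :: "real^3" where
  "X3 = axis 3 1"

text \<open>Vector fields on Minkowski space are maps \<open>\<real>\<^sup>3 \<Rightarrow> \<real>\<^sup>3\<close>. The Levi-Civita connection of the
  (constant-coefficient) metric annihilates the coordinate fields, so it is the componentwise
  directional derivative.\<close>

definition nabla_L :: "(real^3 \<Rightarrow> real^3) \<Rightarrow> (real^3 \<Rightarrow> real^3) \<Rightarrow> real^3 \<Rightarrow> real^3" where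
  "nabla_L X Y p = frechet_derivative Y (at p) (X p)"

definition nabla_bar :: "(real^3 \<Rightarrow> real^3) \<Rightarrow> (real^3 \<Rightarrow> real^3) \<Rightarrow> real^3 \<Rightarrow> real^3" where
  "nabla_bar X Y p = nabla_L X Y p + mink (Y p) X3 *\<^sub>R X p"

definition partial_u :: "(real \<times> real \<Rightarrow> real^3) \<Rightarrow> real \<times> real \<Rightarrow> real^3" where
  "partial_u Y q = vector_derivative (\<lambda>s. Y (s, snd q)) (at (fst q))"

definition partial_v :: "(real \<times> real \<Rightarrow> real^3) \<Rightarrow> real \<times> real \<Rightarrow> real^3" where
  "partial_v Y q = vector_derivative (\<lambda>s. Y (fst q, s)) (at (snd q))"

text \<open>The fields \<open>E\<^sub>1 = \<F>\<^sub>u\<close> and \<open>E\<^sub>2 = \<F>\<^sub>v\<close> live only along the surface, so \<open>\<nabla>\<close>-bar is applied to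
  them through the connection it induces on vector fields along \<open>\<F>\<close>; \<open>nabla_bar_u F Y\<close> and
  \<open>nabla_bar_v F Y\<close> are the derivatives of \<open>Y\<close> in the directions \<open>E\<^sub>1\<close> and \<open>E\<^sub>2\<close>. The two lemmas
  below show that they agree with \<^const>\<open>nabla_bar\<close> on every ambient extension of \<open>Y\<close>.\<close>

definition nabla_bar_u ::
  "(real \<times> real \<Rightarrow> real^3) \<Rightarrow> (real \<times> real \<Rightarrow> real^3) \<Rightarrow> real \<times> real \<Rightarrow> real^3" where
  "nabla_bar_u F Y q = partial_u Y q + mink (Y q) X3 *\<^sub>R partial_u F q"

definition nabla_bar_v ::
  "(real \<times> real \<Rightarrow> real^3) \<Rightarrow> (real \<times> real \<Rightarrow> real^3) \<Rightarrow> real \<times> real \<Rightarrow> real^3" where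
  "nabla_bar_v F Y q = partial_v Y q + mink (Y q) X3 *\<^sub>R partial_v F q"

lemma nabla_bar_u_ambient:
  assumes "Y differentiable at (F q)" "(\<lambda>s. F (s, snd q)) differentiable at (fst q)"
    and "X (F q) = partial_u F q"
  shows "nabla_bar_u F (\<lambda>r. Y (F r)) q = nabla_bar X Y (F q)"
proof -
  have "((\<lambda>s. F (s, snd q)) has_vector_derivative partial_u F q) (at (fst q))"
    using assms(2) unfolding partial_u_def by (simp add: vector_derivative_works[symmetric])
  moreover have "(Y has_derivative frechet_derivative Y (at (F q))) (at (F (fst q, snd q)))"
    using assms(1) by (simp add: frechet_derivative_works)
  ultimately have "((\<lambda>s. Y (F (s, snd q))) has_vector_derivative
      frechet_derivative Y (at (F q)) (partial_u F q)) (at (fst q))"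
    using vector_derivative_diff_chain_within[of "\<lambda>s. F (s, snd q)" _ "fst q" UNIV Y]
    by (simp add: o_def has_derivative_at_withinI)
  then have "partial_u (\<lambda>r. Y (F r)) q = frechet_derivative Y (at (F q)) (partial_u F q)"
    unfolding partial_u_def by (rule vector_derivative_at)
  then show ?thesis
    by (simp add: nabla_bar_u_def nabla_bar_def nabla_L_def assms(3))
qed

lemma nabla_bar_v_ambient:
  assumes "Y differentiable at (F q)" "(\<lambda>s. F (fst q, s)) differentiable at (snd q)"
    and "X (F q) = partial_v F q"
  shows "nabla_bar_v F (\<lambda>r. Y (F r)) q = nabla_bar X Y (F q)"
proof -
  have "((\<lambda>s. F (fst q, s)) has_vector_derivative partial_v F q) (at (snd q))"
    using assms(2) unfolding partial_v_def by (simp add: vector_derivative_works[symmetric])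
  moreover have "(Y has_derivative frechet_derivative Y (at (F q))) (at (F (fst q, snd q)))"
    using assms(1) by (simp add: frechet_derivative_works)
  ultimately have "((\<lambda>s. Y (F (fst q, s))) has_vector_derivative
      frechet_derivative Y (at (F q)) (partial_v F q)) (at (snd q))"
    using vector_derivative_diff_chain_within[of "\<lambda>s. F (fst q, s)" _ "snd q" UNIV Y]
    by (simp add: o_def has_derivative_at_withinI)
  then have "partial_v (\<lambda>r. Y (F r)) q = frechet_derivative Y (at (F q)) (partial_v F q)"
    unfolding partial_v_def by (rule vector_derivative_at)
  then show ?thesis
    by (simp add: nabla_bar_v_def nabla_bar_def nabla_L_def assms(3))
qed

text \<open>Positive definiteness of the first fundamental form, tested on all tangent vectors
  \<open>a E\<^sub>1 + b E\<^sub>2\<close>.\<close>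

definition spacelike_on :: "(real \<times> real) set \<Rightarrow> (real \<times> real \<Rightarrow> real^3) \<Rightarrow> bool" where
  "spacelike_on D F \<longleftrightarrow>
     (\<forall>q\<in>D. \<forall>a b. (a, b) \<noteq> (0, 0) \<longrightarrow>
        (let w = a *\<^sub>R partial_u F q + b *\<^sub>R partial_v F q in mink w w > 0))"

text \<open>No regularity of \<open>N\<close> is demanded: the minimality condition does not differentiate \<open>N\<close>, and
  at each point of a spacelike surface \<open>N\<close> is determined up to sign.\<close>

definition unit_normal_on ::
  "(real \<times> real) set \<Rightarrow> (real \<times> real \<Rightarrow> real^3) \<Rightarrow> (real \<times> real \<Rightarrow> real^3) \<Rightarrow> bool" where
  "unit_normal_on D F N \<longleftrightarrow>
     (\<forall>q\<in>D. mink (N q) (partial_u F q) = 0 \<and> mink (N q) (partial_v F q) = 0 \<and>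
        mink (N q) (N q) = -1)"

definition minimal_on ::
  "(real \<times> real) set \<Rightarrow> (real \<times> real \<Rightarrow> real^3) \<Rightarrow> (real \<times> real \<Rightarrow> real^3) \<Rightarrow> bool" where
  "minimal_on D F N \<longleftrightarrow>
     (\<forall>q\<in>D. let E1 = partial_u F; E2 = partial_v F;
            E = mink (E1 q) (E1 q); F12 = mink (E1 q) (E2 q); G = mink (E2 q) (E2 q)
        in G * mink (nabla_bar_u F E1 q) (N q) - F12 * mink (nabla_bar_u F E2 q) (N q)
         - F12 * mink (nabla_bar_v F E1 q) (N q) + E * mink (nabla_bar_v F E2 q) (N q) = 0)"

definition translation_surface ::
  "(real \<Rightarrow> real) \<Rightarrow> (real \<Rightarrow> real) \<Rightarrow> real \<times> real \<Rightarrow> real^3" where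
  "translation_surface f g = (\<lambda>(u, v). vector [u, v, f u + g v])"

text \<open>Intended for open \<open>I\<close> only, where the iterated derivatives on \<open>I\<close> do not depend on the values
  of \<open>f\<close> outside \<open>I\<close>.\<close>

definition smooth_on_interval :: "real set \<Rightarrow> (real \<Rightarrow> real) \<Rightarrow> bool" where
  "smooth_on_interval I f \<longleftrightarrow> (\<forall>n. (deriv ^^ n) f differentiable_on I)"

end

theory Submission
  imports Defs
begin

text \<open>
  The connection \<open>\<nabla>\<close>-bar differs from the Levi-Civita connection by a multiple of its direction
  argument. For the directions \<open>E\<^sub>1\<close>, \<open>E\<^sub>2\<close> this extra term is tangent to the surface, hence
  orthogonal to \<open>N\<close>, and so minimality is the classical equation for maximal surfaces. For a
  translation graph the only second derivatives that survive are those of \<open>f\<close> and \<open>g\<close>, both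
  pointing in the \<open>z\<close> direction; as \<open>N\<close> is timelike, its third component cannot vanish and cancels,
  which leaves \<open>(1 - g'\<^sup>2) f'' + (1 - f'\<^sup>2) g'' = 0\<close>
  (\<open>minimal_translation_surface_iff\<close>). Being spacelike forces \<open>f'\<^sup>2 < 1\<close> and \<open>g'\<^sup>2 < 1\<close>, so the
  variables separate: \<open>f'' = k (1 - f'\<^sup>2)\<close> and \<open>g'' = - k (1 - g'\<^sup>2)\<close> with a common constant \<open>k\<close>.

  If \<open>k = 0\<close> both functions are affine. If \<open>k \<noteq> 0\<close>, the substitution \<open>w = exp (k f)\<close> linearises the
  first equation to \<open>w'' = k\<^sup>2 w\<close>, so \<open>w\<close> is a combination of \<open>exp (k u)\<close> and \<open>exp (- k u)\<close>, and the
  two coefficients are positive because \<open>f'\<^sup>2 < 1\<close>; taking the logarithm yields \<open>f\<close>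
  (\<open>tanh_equation_solution\<close>). The equation for \<open>g\<close> is the same one with \<open>- k\<close> in place of \<open>k\<close>.
  Conversely, the functions in the two forms are shown to satisfy the separated equations by
  differentiation.
\<close>

section \<open>Minimality as a differential equation\<close>

lemma has_vector_derivative_vector_3:
  assumes "(a has_real_derivative a') (at x)" "(b has_real_derivative b') (at x)"
    and "(c has_real_derivative c') (at x)"
  shows "((\<lambda>s. vector [a s, b s, c s] :: real^3) has_vector_derivative vector [a', b', c']) (at x)"
proof -
  have axes: "(vector [p, q, r] :: real^3) = p *\<^sub>R axis 1 1 + q *\<^sub>R axis 2 1 + r *\<^sub>R axis 3 1"
    for p q r :: real
    by (simp add: vec_eq_iff forall_3 axis_def)
  show ?thesis
    unfolding axes using assms by (auto intro!: derivative_eq_intros)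
qed

lemma partial_u_translation_surface:
  assumes "(f has_real_derivative f') (at u)"
  shows "partial_u (translation_surface f g) (u, v) = vector [1, 0, f']"
  unfolding partial_u_def translation_surface_def
  by (rule vector_derivative_at, simp,
      rule has_vector_derivative_vector_3) (auto intro!: derivative_eq_intros assms)

lemma partial_v_translation_surface:
  assumes "(g has_real_derivative g') (at v)"
  shows "partial_v (translation_surface f g) (u, v) = vector [0, 1, g']"
  unfolding partial_v_def translation_surface_def
  by (rule vector_derivative_at, simp,
      rule has_vector_derivative_vector_3) (auto intro!: derivative_eq_intros assms)

lemma spacelike_translation_surface_slopes:
  assumes "spacelike_on (I \<times> J) (translation_surface f g)" "u \<in> I" "v \<in> J"
    and f': "(f has_real_derivative f') (at u)" and g': "(g has_real_derivative g') (at v)"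
  shows "f'\<^sup>2 < 1" "g'\<^sup>2 < 1"
proof -
  let ?w = "\<lambda>a b. a *\<^sub>R partial_u (translation_surface f g) (u, v)
                 + b *\<^sub>R partial_v (translation_surface f g) (u, v)"
  have pos: "mink (?w a b) (?w a b) > 0" if "(a, b) \<noteq> (0, 0)" for a b
    using assms(1-3) that unfolding spacelike_on_def Let_def by blast
  show "f'\<^sup>2 < 1" "g'\<^sup>2 < 1"
    using pos[of 1 0] pos[of 0 1]
    by (simp_all add: partial_u_translation_surface[OF f'] partial_v_translation_surface[OF g']
        mink_def power2_eq_square)
qed

text \<open>The correction terms of \<open>\<nabla>\<close>-bar are multiples of \<open>E\<^sub>1\<close> or \<open>E\<^sub>2\<close> and are annihilated by \<open>N\<close>,
  and the mixed derivatives of a translation surface vanish, so that only the two pure second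
  derivatives contribute, each with the nonzero factor \<open>- N\<^sub>3\<close>.\<close>

lemma minimal_translation_surface_iff:
  assumes "open I" "open J"
    and f1: "\<And>u. u \<in> I \<Longrightarrow> (f has_real_derivative f1 u) (at u)"
    and f2: "\<And>u. u \<in> I \<Longrightarrow> (f1 has_real_derivative f2 u) (at u)"
    and g1: "\<And>v. v \<in> J \<Longrightarrow> (g has_real_derivative g1 v) (at v)"
    and g2: "\<And>v. v \<in> J \<Longrightarrow> (g1 has_real_derivative g2 v) (at v)"
    and N: "unit_normal_on (I \<times> J) (translation_surface f g) N"
  shows "minimal_on (I \<times> J) (translation_surface f g) N \<longleftrightarrow>
    (\<forall>u\<in>I. \<forall>v\<in>J. (1 - (g1 v)\<^sup>2) * f2 u + (1 - (f1 u)\<^sup>2) * g2 v = 0)"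
proof -
  let ?F = "translation_surface f g"
  let ?H = "\<lambda>q. let E1 = partial_u ?F; E2 = partial_v ?F;
            E = mink (E1 q) (E1 q); F12 = mink (E1 q) (E2 q); G = mink (E2 q) (E2 q)
        in G * mink (nabla_bar_u ?F E1 q) (N q) - F12 * mink (nabla_bar_u ?F E2 q) (N q)
         - F12 * mink (nabla_bar_v ?F E1 q) (N q) + E * mink (nabla_bar_v ?F E2 q) (N q)"
  have "?H (u, v) = 0 \<longleftrightarrow> (1 - (g1 v)\<^sup>2) * f2 u + (1 - (f1 u)\<^sup>2) * g2 v = 0"
    if u: "u \<in> I" and v: "v \<in> J" for u v
  proof -
    have Eu: "partial_u ?F (s, t) = vector [1, 0, f1 s]" if "s \<in> I" for s t
      using f1[OF that] by (rule partial_u_translation_surface)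
    have Ev: "partial_v ?F (s, t) = vector [0, 1, g1 t]" if "t \<in> J" for s t
      using g1[OF that] by (rule partial_v_translation_surface)
    have uu: "partial_u (partial_u ?F) (u, v) = vector [0, 0, f2 u]"
      unfolding partial_u_def[of "partial_u ?F"] fst_conv snd_conv
      by (rule vector_derivative_at, rule has_vector_derivative_transform_within_open
          [OF has_vector_derivative_vector_3[OF DERIV_const DERIV_const f2[OF u]] \<open>open I\<close> u])
        (simp add: Eu)
    have vv: "partial_v (partial_v ?F) (u, v) = vector [0, 0, g2 v]"
      unfolding partial_v_def[of "partial_v ?F"] fst_conv snd_conv
      by (rule vector_derivative_at, rule has_vector_derivative_transform_within_open
          [OF has_vector_derivative_vector_3[OF DERIV_const DERIV_const g2[OF v]] \<open>open J\<close> v])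
        (simp add: Ev)
    have uv: "partial_u (partial_v ?F) (u, v) = 0"
      unfolding partial_u_def[of "partial_v ?F"] by (simp add: Ev[OF v])
    have vu: "partial_v (partial_u ?F) (u, v) = 0"
      unfolding partial_v_def[of "partial_u ?F"] by (simp add: Eu[OF u])
    define n1 n2 n3 where n: "n1 = N (u, v) $ 1" "n2 = N (u, v) $ 2" "n3 = N (u, v) $ 3"
    have "mink (N (u, v)) (partial_u ?F (u, v)) = 0" "mink (N (u, v)) (partial_v ?F (u, v)) = 0"
      and "mink (N (u, v)) (N (u, v)) = -1"
      using N u v unfolding unit_normal_on_def by blast+
    then have n12: "n1 = n3 * f1 u" "n2 = n3 * g1 v" and "n1 * n1 + n2 * n2 - n3 * n3 = -1"
      by (simp_all add: Eu[OF u] Ev[OF v] mink_def n)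
    then have "n3 \<noteq> 0"
      by auto
    moreover have "?H (u, v) = - n3 * ((1 - (g1 v)\<^sup>2) * f2 u + (1 - (f1 u)\<^sup>2) * g2 v)"
      by (simp add: Let_def nabla_bar_u_def nabla_bar_v_def Eu[OF u] Ev[OF v] uu vv uv vu
          mink_def X3_def axis_def n[symmetric] n12 power2_eq_square algebra_simps)
    ultimately show ?thesis
      by simp
  qed
  then show ?thesis
    unfolding minimal_on_def by (auto simp: Let_def)
qed

section \<open>The separated equations\<close>

lemma constant_on_interval:
  fixes h :: "real \<Rightarrow> real"
  assumes "is_interval I" "\<And>u. u \<in> I \<Longrightarrow> (h has_real_derivative 0) (at u)"
  obtains C where "\<And>u. u \<in> I \<Longrightarrow> h u = C"
  using has_field_derivative_zero_constant[of I h] assms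
  by (auto simp: is_interval_convex_1 intro: has_field_derivative_at_within)

lemma affine_if_second_derivative_zero:
  fixes f f1 :: "real \<Rightarrow> real"
  assumes "is_interval I"
    and f1: "\<And>u. u \<in> I \<Longrightarrow> (f has_real_derivative f1 u) (at u)"
    and f2: "\<And>u. u \<in> I \<Longrightarrow> (f1 has_real_derivative 0) (at u)"
  obtains m b where "\<And>u. u \<in> I \<Longrightarrow> f u = m * u + b"
proof -
  obtain m where m: "\<And>u. u \<in> I \<Longrightarrow> f1 u = m"
    using constant_on_interval[OF assms(1) f2] by blast
  have "((\<lambda>u. f u - m * u) has_real_derivative 0) (at u)" if "u \<in> I" for u
    using f1[OF that] m[OF that] by (auto intro!: derivative_eq_intros)
  then obtain b where "\<And>u. u \<in> I \<Longrightarrow> f u - m * u = b"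
    using constant_on_interval[OF assms(1)] by blast
  then show ?thesis
    using that[of m b] by (simp add: algebra_simps)
qed

text \<open>For \<open>k \<noteq> 0\<close>, the equation satisfied by \<open>f\<close> makes \<open>w = exp (k f)\<close> a solution of
  \<open>w'' = k\<^sup>2 w\<close>. The functions \<open>exp (- k u) (w + w' / k)\<close> and \<open>exp (k u) (w - w' / k)\<close> are therefore
  constant, and positive because \<open>w' / k = f' w\<close> and \<open>\<bar>f'\<bar> < 1\<close>. The ratio of the second
  to the first is \<open>- c\<close>.\<close>

lemma tanh_equation_solution:
  fixes f f1 f2 :: "real \<Rightarrow> real"
  assumes "is_interval I" "I \<noteq> {}" "k \<noteq> 0"
    and f1: "\<And>u. u \<in> I \<Longrightarrow> (f has_real_derivative f1 u) (at u)"
    and f2: "\<And>u. u \<in> I \<Longrightarrow> (f1 has_real_derivative f2 u) (at u)"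
    and eq: "\<And>u. u \<in> I \<Longrightarrow> f2 u = k * (1 - (f1 u)\<^sup>2)"
    and bound: "\<And>u. u \<in> I \<Longrightarrow> (f1 u)\<^sup>2 < 1"
  obtains c a where "c < 0"
    and "\<And>u. u \<in> I \<Longrightarrow> f u = 1 / k * ln \<bar>exp (k * u) - c * exp (- k * u)\<bar> + a"
proof -
  have "((\<lambda>u. exp (k * f u - k * u) * (1 + f1 u)) has_real_derivative 0) (at u)"
    if "u \<in> I" for u
    by (auto intro!: derivative_eq_intros f1[OF that] f2[OF that, unfolded eq[OF that]]
        simp: power2_eq_square algebra_simps)
  then obtain A where A: "\<And>u. u \<in> I \<Longrightarrow> exp (k * f u - k * u) * (1 + f1 u) = A"
    using constant_on_interval[OF assms(1)] by blast
  have "((\<lambda>u. exp (k * f u + k * u) * (1 - f1 u)) has_real_derivative 0) (at u)"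
    if "u \<in> I" for u
    by (auto intro!: derivative_eq_intros f1[OF that] f2[OF that, unfolded eq[OF that]]
        simp: power2_eq_square algebra_simps)
  then obtain B where B: "\<And>u. u \<in> I \<Longrightarrow> exp (k * f u + k * u) * (1 - f1 u) = B"
    using constant_on_interval[OF assms(1)] by blast
  obtain u0 where u0: "u0 \<in> I"
    using assms(2) by blast
  have "\<bar>f1 u0\<bar> < 1"
    using bound[OF u0] by (simp add: abs_square_less_1)
  then have pos: "A > 0" "B > 0"
    using A[OF u0] B[OF u0] by (auto intro!: mult_pos_pos simp flip: A[OF u0] B[OF u0])
  have "f u = 1 / k * ln \<bar>exp (k * u) - (- B / A) * exp (- k * u)\<bar> + ln (A / 2) / k"
    if u: "u \<in> I" for u
  proof -
    have "A * exp (k * u) + B * exp (- k * u) = 2 * exp (k * f u)"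
      by (simp add: A[OF u, symmetric] B[OF u, symmetric] exp_diff exp_add exp_minus field_simps)
    then have w: "exp (k * f u) = A / 2 * (exp (k * u) + B / A * exp (- k * u))"
      using pos by (simp add: field_simps)
    have "k * f u = ln (A / 2 * (exp (k * u) + B / A * exp (- k * u)))"
      by (metis w ln_exp)
    also have "\<dots> = ln (A / 2) + ln (exp (k * u) + B / A * exp (- k * u))"
      using pos by (intro ln_mult_pos add_pos_pos mult_pos_pos) auto
    also have "exp (k * u) + B / A * exp (- k * u) = \<bar>exp (k * u) - (- B / A) * exp (- k * u)\<bar>"
      using pos by (simp add: add_pos_pos)
    finally show ?thesis
      using \<open>k \<noteq> 0\<close> by (simp add: field_simps)
  qed
  then show ?thesis
    using that[of "- B / A" "ln (A / 2) / k"] pos by simp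
qed

lemma DERIV_ln_abs:
  fixes x :: real
  assumes "x \<noteq> 0"
  shows "((\<lambda>x. ln \<bar>x\<bar>) has_real_derivative 1 / x) (at x)"
proof (cases "x > 0")
  case True
  show ?thesis
    by (rule has_field_derivative_transform_within_open[OF DERIV_ln_divide[OF True], of "{0<..}"])
      (use True in auto)
next
  case False
  have "((\<lambda>x. ln (- x)) has_real_derivative 1 / x) (at x)"
    using False assms by (auto intro!: derivative_eq_intros)
  then show ?thesis
    by (rule has_field_derivative_transform_within_open[of _ _ _ "{..<0}"])
      (use False assms in auto)
qed

text \<open>The converse holds for every \<open>c\<close>: the derivative of \<open>f\<close> is a shifted \<open>tanh (k u)\<close> for
  \<open>c < 0\<close>, a shifted \<open>coth (k u)\<close> for \<open>c > 0\<close> and the constant 1 for \<open>c = 0\<close>, and all three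
  satisfy the same Riccati equation.\<close>

lemma log_solution_derivatives:
  fixes f f1 f2 :: "real \<Rightarrow> real"
  assumes "open I" "k \<noteq> 0"
    and nz: "\<And>u. u \<in> I \<Longrightarrow> exp (k * u) - c * exp (- k * u) \<noteq> 0"
    and f: "\<And>u. u \<in> I \<Longrightarrow> f u = 1 / k * ln \<bar>exp (k * u) - c * exp (- k * u)\<bar> + a"
    and f1: "\<And>u. u \<in> I \<Longrightarrow> (f has_real_derivative f1 u) (at u)"
    and f2: "\<And>u. u \<in> I \<Longrightarrow> (f1 has_real_derivative f2 u) (at u)"
    and u: "u \<in> I"
  shows "f2 u = k * (1 - (f1 u)\<^sup>2)"
proof -
  define d where "d u = exp (k * u) - c * exp (- k * u)" for u
  define n where "n u = exp (k * u) + c * exp (- k * u)" for u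
  have d: "(d has_real_derivative k * n x) (at x)" for x
    unfolding d_def n_def by (auto intro!: derivative_eq_intros simp: algebra_simps)
  have n: "(n has_real_derivative k * d x) (at x)" for x
    unfolding d_def n_def by (auto intro!: derivative_eq_intros simp: algebra_simps)
  have f1_eq: "f1 x = n x / d x" if x: "x \<in> I" for x
  proof -
    have dx: "d x \<noteq> 0"
      using nz[OF x] by (simp add: d_def)
    have "((\<lambda>x. 1 / k * ln \<bar>d x\<bar> + a) has_real_derivative n x / d x) (at x)"
    proof -
      have "((\<lambda>x. ln \<bar>d x\<bar>) has_real_derivative (k * n x) / d x) (at x)"
        using DERIV_chain2[OF DERIV_ln_abs[OF dx] d] by simp
      from DERIV_add[OF DERIV_cmult[OF this, of "1 / k"] DERIV_const[of a]] show ?thesis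
        using \<open>k \<noteq> 0\<close> by simp
    qed
    then have "(f has_real_derivative n x / d x) (at x)"
      by (rule has_field_derivative_transform_within_open[OF _ \<open>open I\<close> x])
        (simp add: f d_def)
    then show ?thesis
      using f1[OF x] by (rule DERIV_unique[symmetric])
  qed
  have du: "d u \<noteq> 0"
    using nz[OF u] by (simp add: d_def)
  have "((\<lambda>x. n x / d x) has_real_derivative (k * d u * d u - n u * (k * n u)) / (d u * d u)) (at u)"
    by (rule DERIV_divide[OF n d du])
  then have "(f1 has_real_derivative (k * d u * d u - n u * (k * n u)) / (d u * d u)) (at u)"
    by (rule has_field_derivative_transform_within_open[OF _ \<open>open I\<close> u]) (simp add: f1_eq)
  then have "f2 u = (k * d u * d u - n u * (k * n u)) / (d u * d u)"
    using f2[OF u] by (rule DERIV_unique[symmetric])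
  also have "\<dots> = k * (1 - (f1 u)\<^sup>2)"
    using du by (simp add: f1_eq[OF u] field_simps power2_eq_square)
  finally show ?thesis .
qed

lemma affine_second_derivative:
  fixes f f1 f2 :: "real \<Rightarrow> real"
  assumes "open I"
    and f: "\<And>u. u \<in> I \<Longrightarrow> f u = m * u + b"
    and f1: "\<And>u. u \<in> I \<Longrightarrow> (f has_real_derivative f1 u) (at u)"
    and f2: "\<And>u. u \<in> I \<Longrightarrow> (f1 has_real_derivative f2 u) (at u)"
    and u: "u \<in> I"
  shows "f2 u = 0"
proof -
  have f1_eq: "f1 x = m" if x: "x \<in> I" for x
  proof -
    have "((\<lambda>x. m * x + b) has_real_derivative m) (at x)"
      by (auto intro!: derivative_eq_intros)
    then have "(f has_real_derivative m) (at x)"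
      by (rule has_field_derivative_transform_within_open[OF _ \<open>open I\<close> x]) (simp add: f)
    then show ?thesis
      using f1[OF x] by (rule DERIV_unique[symmetric])
  qed
  have "(f1 has_real_derivative 0) (at u)"
    by (rule has_field_derivative_transform_within_open[OF DERIV_const \<open>open I\<close> u])
      (simp add: f1_eq)
  then show ?thesis
    using f2[OF u] by (rule DERIV_unique[symmetric])
qed

text \<open>Dividing by the two positive factors puts a function of \<open>u\<close> on one side and a function of \<open>v\<close>
  on the other; the common value \<open>k\<close> is read off at a base point.\<close>

lemma separation_constant:
  fixes p q x y :: "real \<Rightarrow> real"
  assumes "J \<noteq> {}"
    and p: "\<And>u. u \<in> I \<Longrightarrow> p u > 0" and q: "\<And>v. v \<in> J \<Longrightarrow> q v > 0"
    and eq: "\<And>u v. u \<in> I \<Longrightarrow> v \<in> J \<Longrightarrow> q v * x u + p u * y v = 0"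
    and "I \<noteq> {}"
  obtains k where "\<And>u. u \<in> I \<Longrightarrow> x u = k * p u" "\<And>v. v \<in> J \<Longrightarrow> y v = - k * q v"
proof -
  obtain u0 v0 where "u0 \<in> I" "v0 \<in> J"
    using assms(1,5) by blast
  define k where "k = - y v0 / q v0"
  have x: "x u = k * p u" if "u \<in> I" for u
    using eq[OF that \<open>v0 \<in> J\<close>] q[OF \<open>v0 \<in> J\<close>] by (simp add: k_def field_simps)
  have "y v = - k * q v" if "v \<in> J" for v
  proof -
    have "p u0 * (y v + k * q v) = 0"
      using eq[OF \<open>u0 \<in> I\<close> that] x[OF \<open>u0 \<in> I\<close>] by (simp add: algebra_simps)
    then show ?thesis
      using p[OF \<open>u0 \<in> I\<close>] by simp
  qed
  with x show ?thesis
    using that by blast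
qed

section \<open>Classification\<close>

lemma smooth_on_interval_DERIV:
  assumes "open I" "smooth_on_interval I f" "u \<in> I"
  shows "(f has_real_derivative deriv f u) (at u)"
    and "(deriv f has_real_derivative deriv (deriv f) u) (at u)"
proof -
  have "(deriv ^^ n) f differentiable at u" for n
    using assms unfolding smooth_on_interval_def
    by (metis at_within_open differentiable_on_def)
  from this[of 0] this[of 1] show "(f has_real_derivative deriv f u) (at u)"
    and "(deriv f has_real_derivative deriv (deriv f) u) (at u)"
    by (simp_all add: DERIV_deriv_iff_real_differentiable)
qed

text \<open>The factor \<open>1 / (- k)\<close> exhibits the second summand as a solution of the equation with rate
  \<open>- k\<close>, the one that governs \<open>g\<close>.\<close>

lemma ln_abs_quotient_split:
  fixes x y k :: real
  assumes "x \<noteq> 0" "y \<noteq> 0"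
  shows "1 / k * ln (\<bar>x\<bar> / \<bar>y\<bar>) = 1 / k * ln \<bar>x\<bar> + 1 / (- k) * ln \<bar>y\<bar>"
  using assms by (simp add: ln_div algebra_simps)

theorem theorem3p3:
  fixes I J :: "real set" and f g :: "real \<Rightarrow> real"
    and F N :: "real \<times> real \<Rightarrow> real^3"
  assumes "open I" "is_interval I" "I \<noteq> {}"
    and "open J" "is_interval J" "J \<noteq> {}"
    and "smooth_on_interval I f" "smooth_on_interval J g"
    and "F = translation_surface f g"
    and "spacelike_on (I \<times> J) F"
    and "unit_normal_on (I \<times> J) F N"
  shows "minimal_on (I \<times> J) F N \<longleftrightarrow>
     (\<exists>c1 c2 c3 :: real. \<forall>u\<in>I. \<forall>v\<in>J. F (u, v) = vector [u, v, c1 * u + c2 * v + c3]) \<or>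
     (\<exists>a c0 c c' :: real. c0 \<noteq> 0 \<and> c \<noteq> 0 \<and> c' \<noteq> 0 \<and>
        (\<forall>u\<in>I. exp (c0 * u) - c * exp (- c0 * u) \<noteq> 0) \<and>
        (\<forall>v\<in>J. exp (- c0 * v) - c' * exp (c0 * v) \<noteq> 0) \<and>
        (\<forall>u\<in>I. \<forall>v\<in>J. F (u, v) =
           vector [u, v,
             1 / c0 * ln (\<bar>exp (c0 * u) - c * exp (- c0 * u)\<bar> /
                          \<bar>exp (- c0 * v) - c' * exp (c0 * v)\<bar>) + a]))"
proof -
  define f1 f2 g1 g2 where d: "f1 = deriv f" "f2 = deriv f1" "g1 = deriv g" "g2 = deriv g1"
  have f1: "\<And>u. u \<in> I \<Longrightarrow> (f has_real_derivative f1 u) (at u)"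
    and f2: "\<And>u. u \<in> I \<Longrightarrow> (f1 has_real_derivative f2 u) (at u)"
    and g1: "\<And>v. v \<in> J \<Longrightarrow> (g has_real_derivative g1 v) (at v)"
    and g2: "\<And>v. v \<in> J \<Longrightarrow> (g1 has_real_derivative g2 v) (at v)"
    unfolding d using smooth_on_interval_DERIV assms by blast+
  have F: "F (u, v) = vector [u, v, f u + g v]" for u v
    by (simp add: assms translation_surface_def)
  have F_eq: "F (u, v) = vector [u, v, z] \<longleftrightarrow> f u + g v = z" for u v z
    by (auto simp: F vec_eq_iff forall_3)
  obtain u0 v0 where u0: "u0 \<in> I" and v0: "v0 \<in> J"
    using assms(3,6) by blast
  have f_slope: "(f1 u)\<^sup>2 < 1" if "u \<in> I" for u
    using spacelike_translation_surface_slopes(1)[OF _ that v0 f1[OF that] g1[OF v0]] assms(9,10)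
    by blast
  have g_slope: "(g1 v)\<^sup>2 < 1" if "v \<in> J" for v
    using spacelike_translation_surface_slopes(2)[OF _ u0 that f1[OF u0] g1[OF that]] assms(9,10)
    by blast
  have minimal: "minimal_on (I \<times> J) F N \<longleftrightarrow>
      (\<forall>u\<in>I. \<forall>v\<in>J. (1 - (g1 v)\<^sup>2) * f2 u + (1 - (f1 u)\<^sup>2) * g2 v = 0)"
    unfolding assms(9)
    using minimal_translation_surface_iff[OF assms(1,4) f1 f2 g1 g2] assms(9,11) by blast
  show ?thesis (is "_ \<longleftrightarrow> ?affine \<or> ?log")
  proof
    assume "minimal_on (I \<times> J) F N"
    then have "\<And>u v. u \<in> I \<Longrightarrow> v \<in> J \<Longrightarrow> (1 - (g1 v)\<^sup>2) * f2 u + (1 - (f1 u)\<^sup>2) * g2 v = 0"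
      using minimal by blast
    moreover have "\<And>u. u \<in> I \<Longrightarrow> 1 - (f1 u)\<^sup>2 > 0" "\<And>v. v \<in> J \<Longrightarrow> 1 - (g1 v)\<^sup>2 > 0"
      using f_slope g_slope by simp_all
    ultimately obtain k where kf: "\<And>u. u \<in> I \<Longrightarrow> f2 u = k * (1 - (f1 u)\<^sup>2)"
      and kg: "\<And>v. v \<in> J \<Longrightarrow> g2 v = - k * (1 - (g1 v)\<^sup>2)"
      using separation_constant[of J I "\<lambda>u. 1 - (f1 u)\<^sup>2" "\<lambda>v. 1 - (g1 v)\<^sup>2" f2 g2] assms(3,6)
      by blast
    show "?affine \<or> ?log"
    proof (cases "k = 0")
      case True
      have f2_0: "\<And>u. u \<in> I \<Longrightarrow> (f1 has_real_derivative 0) (at u)"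
        and g2_0: "\<And>v. v \<in> J \<Longrightarrow> (g1 has_real_derivative 0) (at v)"
        using f2 kf g2 kg True by fastforce+
      obtain c1 b1 where fa: "\<And>u. u \<in> I \<Longrightarrow> f u = c1 * u + b1"
        using affine_if_second_derivative_zero[OF assms(2) f1 f2_0] by blast
      obtain c2 b2 where ga: "\<And>v. v \<in> J \<Longrightarrow> g v = c2 * v + b2"
        using affine_if_second_derivative_zero[OF assms(5) g1 g2_0] by blast
      have "\<forall>u\<in>I. \<forall>v\<in>J. F (u, v) = vector [u, v, c1 * u + c2 * v + (b1 + b2)]"
        by (simp add: F_eq fa ga)
      then show ?thesis
        by blast
    next
      case False
      obtain c a where c: "c < 0"
        and fl: "\<And>u. u \<in> I \<Longrightarrow> f u = 1 / k * ln \<bar>exp (k * u) - c * exp (- k * u)\<bar> + a"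
        using tanh_equation_solution[OF assms(2,3) False f1 f2 kf f_slope] by blast
      obtain c' a' where c': "c' < 0"
        and gl: "\<And>v. v \<in> J \<Longrightarrow> g v = 1 / (- k) * ln \<bar>exp (- k * v) - c' * exp (- (- k) * v)\<bar> + a'"
        using tanh_equation_solution[OF assms(5,6) _ g1 g2 kg g_slope] False
        by (metis neg_equal_0_iff_equal)
      have pos: "exp x - c * exp y > 0" "exp x - c' * exp y > 0" for x y
        using c c' by (smt (verit) exp_gt_zero mult_neg_pos)+
      have nz: "exp x - c * exp y \<noteq> 0" "exp x - c' * exp y \<noteq> 0" for x y
        using pos[of x y] by simp_all
      have "\<forall>u\<in>I. \<forall>v\<in>J. F (u, v) = vector [u, v,
          1 / k * ln (\<bar>exp (k * u) - c * exp (- k * u)\<bar> / \<bar>exp (- k * v) - c' * exp (k * v)\<bar>)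
            + (a + a')]"
        unfolding F_eq ln_abs_quotient_split[OF nz] by (simp add: fl gl)
      then have ?log
        using False c c' nz by (metis less_irrefl)
      then show ?thesis ..
    qed
  next
    \<comment> \<open>Either form determines \<open>f\<close> and \<open>g\<close> up to additive constants, by freezing the other variable
      at the base point.\<close>
    assume "?affine \<or> ?log"
    then show "minimal_on (I \<times> J) F N"
    proof
      assume ?affine
      then obtain c1 c2 c3 where eq: "\<And>u v. u \<in> I \<Longrightarrow> v \<in> J \<Longrightarrow> f u + g v = c1 * u + c2 * v + c3"
        unfolding F_eq by blast
      have f: "f u = c1 * u + (c2 * v0 + c3 - g v0)" if "u \<in> I" for u
        using eq[OF that v0] by simp
      have g: "g v = c2 * v + (c1 * u0 + c3 - f u0)" if "v \<in> J" for v
        using eq[OF u0 that] by simp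
      have "f2 u = 0" if "u \<in> I" for u
        using affine_second_derivative[OF assms(1) f f1 f2 that] by blast
      moreover have "g2 v = 0" if "v \<in> J" for v
        using affine_second_derivative[OF assms(4) g g1 g2 that] by blast
      ultimately show ?thesis
        by (simp add: minimal)
    next
      assume ?log
      then obtain a k c c' where k: "k \<noteq> 0"
        and nzf: "\<And>u. u \<in> I \<Longrightarrow> exp (k * u) - c * exp (- k * u) \<noteq> 0"
        and nzg: "\<And>v. v \<in> J \<Longrightarrow> exp (- k * v) - c' * exp (k * v) \<noteq> 0"
        and eq: "\<And>u v. u \<in> I \<Longrightarrow> v \<in> J \<Longrightarrow> f u + g v = 1 / k *
          ln (\<bar>exp (k * u) - c * exp (- k * u)\<bar> / \<bar>exp (- k * v) - c' * exp (k * v)\<bar>) + a"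
        unfolding F_eq by blast
      define P where "P u = 1 / k * ln \<bar>exp (k * u) - c * exp (- k * u)\<bar>" for u
      define Q where "Q v = 1 / (- k) * ln \<bar>exp (- k * v) - c' * exp (k * v)\<bar>" for v
      have PQ: "f u + g v = P u + Q v + a" if "u \<in> I" "v \<in> J" for u v
        using eq[OF that] ln_abs_quotient_split[OF nzf[OF that(1)] nzg[OF that(2)]]
        by (simp add: P_def Q_def)
      have f: "f u = 1 / k * ln \<bar>exp (k * u) - c * exp (- k * u)\<bar> + (Q v0 + a - g v0)"
        if "u \<in> I" for u
        using PQ[OF that v0] by (simp add: P_def)
      have g: "g v = 1 / (- k) * ln \<bar>exp (- k * v) - c' * exp (- (- k) * v)\<bar> + (P u0 + a - f u0)"
        if "v \<in> J" for v
        using PQ[OF u0 that] by (simp add: Q_def)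
      have "f2 u = k * (1 - (f1 u)\<^sup>2)" if "u \<in> I" for u
        using log_solution_derivatives[OF assms(1) k nzf f f1 f2 that] by blast
      moreover have "g2 v = - k * (1 - (g1 v)\<^sup>2)" if "v \<in> J" for v
        by (rule log_solution_derivatives[OF assms(4) _ _ g g1 g2 that]) (use k nzg in auto)
      ultimately have "(1 - (g1 v)\<^sup>2) * f2 u + (1 - (f1 u)\<^sup>2) * g2 v = 0" 
        if "u \<in> I" "v \<in> J" for u v
        using that by simp
      then show ?thesis
        unfolding minimal by blast
    qed
  qed
qed

end
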